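(* Let $P_6^{13254}$ be the edge-ordered path with $6$ vertices and $5$ edges whose edges, listed in order along the path, have labels $1,3,2,5,4$. Then $\mathrm{ex}_<(n,P_6^{13254})=O(n\log^2 n)$.
   Context: An edge-ordered graph is a finite simple graph together with a linear order on its edge set, often given by an injective real labeling of the edges (smaller label means smaller edge). An isomorphism of edge-ordered graphs is a graph isomorphism respecting the edge-order; subgraphs inherit the edge-order. An edge-ordered graph $G$ contains an edge-ordered graph $H$ if $H$ is isomorphic to a (not necessarily induced) subgraph of $G$; otherwise $G$ avoids $H$. For an edge-ordered graph $H$ with at least one edge, $\mathrm{ex}_<(n,H)$ is the maximal number of edges in an edge-ordered graph on $n$ vertices that avoids $H$. *)

theory Defs
  imports "HOL-Library.Landau_Symbols"
begin

text \<open>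
  Edges are two-element vertex sets; \<open>eord\<close> is the (reflexive) linear order on the edge set.
\<close>

record 'a eograph =
  verts :: "'a set"
  edges :: "'a set set"
  eord :: "'a set rel"

definition edge_ordered_graph :: "'a eograph \<Rightarrow> bool" where
  "edge_ordered_graph G \<longleftrightarrow>
     finite (verts G) \<and>
     (\<forall>e\<in>edges G. e \<subseteq> verts G \<and> card e = 2) \<and>
     linear_order_on (edges G) (eord G)"

definition eo_subgraph :: "'a eograph \<Rightarrow> 'a eograph \<Rightarrow> bool" where
  "eo_subgraph S G \<longleftrightarrow>
     edge_ordered_graph S \<and> verts S \<subseteq> verts G \<and> edges S \<subseteq> edges G \<and>
     eord S = Restr (eord G) (edges S)"

definition eo_isomorphism :: "('a \<Rightarrow> 'b) \<Rightarrow> 'a eograph \<Rightarrow> 'b eograph \<Rightarrow> bool" where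
  "eo_isomorphism f G H \<longleftrightarrow>
     bij_betw f (verts G) (verts H) \<and>
     (\<lambda>e. f ` e) ` edges G = edges H \<and>
     (\<forall>e\<in>edges G. \<forall>e'\<in>edges G. (e, e') \<in> eord G \<longleftrightarrow> (f ` e, f ` e') \<in> eord H)"

definition eo_isomorphic :: "'a eograph \<Rightarrow> 'b eograph \<Rightarrow> bool" where
  "eo_isomorphic G H \<longleftrightarrow> (\<exists>f. eo_isomorphism f G H)"

definition eo_contains :: "'a eograph \<Rightarrow> 'b eograph \<Rightarrow> bool" where
  "eo_contains G H \<longleftrightarrow> (\<exists>S. eo_subgraph S G \<and> eo_isomorphic H S)"

abbreviation eo_avoids :: "'a eograph \<Rightarrow> 'b eograph \<Rightarrow> bool" where
  "eo_avoids G H \<equiv> \<not> eo_contains G H"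

text \<open>
  Taking vertices in \<^typ>\<open>nat\<close> loses no generality, since avoidance and edge counts are invariant
  under isomorphism. The maximum is meaningful when \<open>H\<close> has an edge; see
  \<open>finite_avoiding_sizes\<close> and \<open>avoiding_sizes_nonempty\<close> below.
\<close>

definition avoiding_sizes :: "nat \<Rightarrow> 'b eograph \<Rightarrow> nat set" where
  "avoiding_sizes n H =
     {card (edges G) | G :: nat eograph.
        edge_ordered_graph G \<and> card (verts G) = n \<and> eo_avoids G H}"

definition ex_less :: "nat \<Rightarrow> 'b eograph \<Rightarrow> nat" where
  "ex_less n H = Max (avoiding_sizes n H)"

text \<open>
  The path with vertices \<open>0, 1, \<dots>, length ls\<close> in this order, whose \<open>i\<close>-th edge
  \<open>{i, i + 1}\<close> carries the label \<open>ls ! i\<close>. The labels are required to be distinct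
  for this to be an edge-ordered graph.
\<close>

definition eo_path :: "nat list \<Rightarrow> nat eograph" where
  "eo_path ls =
     \<lparr> verts = {0..length ls},
       edges = {{i, Suc i} | i. i < length ls},
       eord = {({i, Suc i}, {j, Suc j}) | i j.
                 i < length ls \<and> j < length ls \<and> ls ! i \<le> ls ! j} \<rparr>"

definition P6_13254 :: "nat eograph" where
  "P6_13254 = eo_path [1, 3, 2, 5, 4]"

lemma path_edge_eq_iff: "{i, Suc i} = {j, Suc j} \<longleftrightarrow> i = j"
  by (auto simp: doubleton_eq_iff)

lemma edge_ordered_graph_eo_path:
  assumes "distinct ls"
  shows "edge_ordered_graph (eo_path ls)"
proof -
  let ?r = "eord (eo_path ls)"
  have mem: "({i, Suc i}, {j, Suc j}) \<in> ?r \<longleftrightarrow> i < length ls \<and> j < length ls \<and> ls ! i \<le> ls ! j"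
    for i j
    by (auto simp: eo_path_def path_edge_eq_iff)
  have E: "e \<in> edges (eo_path ls) \<longleftrightarrow> (\<exists>i<length ls. e = {i, Suc i})" for e
    by (auto simp: eo_path_def)
  have sub: "?r \<subseteq> edges (eo_path ls) \<times> edges (eo_path ls)"
    by (auto simp: eo_path_def)
  have "refl_on (edges (eo_path ls)) ?r"
    by (rule refl_onI) (auto simp: E mem)
  moreover have "trans ?r"
  proof (rule transI)
    fix x y z assume xy: "(x, y) \<in> ?r" and yz: "(y, z) \<in> ?r"
    with sub obtain i j k where "x = {i, Suc i}" "y = {j, Suc j}" "z = {k, Suc k}"
      using E by (meson mem_Sigma_iff subsetD)
    with xy yz show "(x, z) \<in> ?r"
      by (simp add: mem)
  qed
  moreover have "antisym ?r"
  proof (rule antisymI)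
    fix x y assume xy: "(x, y) \<in> ?r" and yx: "(y, x) \<in> ?r"
    with sub obtain i j where ij: "x = {i, Suc i}" "y = {j, Suc j}"
      using E by (meson mem_Sigma_iff subsetD)
    with xy yx have "i < length ls" "j < length ls" "ls ! i = ls ! j"
      by (simp_all add: mem)
    with assms have "i = j"
      by (simp add: nth_eq_iff_index_eq)
    with ij show "x = y"
      by simp
  qed
  moreover have "total_on (edges (eo_path ls)) ?r"
    unfolding total_on_def by (auto simp: E mem)
  ultimately have "linear_order_on (edges (eo_path ls)) ?r"
    using sub by (simp add: linear_order_on_def partial_order_on_def preorder_on_def)
  then show ?thesis
    by (auto simp: edge_ordered_graph_def eo_path_def)
qed

lemma edge_ordered_graph_P6_13254: "edge_ordered_graph P6_13254"
  unfolding P6_13254_def by (rule edge_ordered_graph_eo_path) simp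

lemma finite_avoiding_sizes: "finite (avoiding_sizes n H)"
proof (rule finite_subset)
  show "avoiding_sizes n H \<subseteq> {..2 ^ n}"
  proof
    fix m assume "m \<in> avoiding_sizes n H"
    then obtain G :: "nat eograph" where G: "edge_ordered_graph G" "card (verts G) = n"
      and m: "m = card (edges G)"
      unfolding avoiding_sizes_def by blast
    have "edges G \<subseteq> Pow (verts G)" "finite (verts G)"
      using G(1) unfolding edge_ordered_graph_def by auto
    then show "m \<in> {..2 ^ n}"
      using card_mono[of "Pow (verts G)" "edges G"] G(2) m by (simp add: card_Pow)
  qed
qed simp

lemma avoiding_sizes_nonempty:
  assumes "edges H \<noteq> {}"
  shows "avoiding_sizes n H \<noteq> {}"
proof -
  define G :: "nat eograph" where "G = \<lparr>verts = {..<n}, edges = {}, eord = {}\<rparr>"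
  have "edge_ordered_graph G"
    by (simp add: G_def edge_ordered_graph_def)
  moreover have "eo_avoids G H"
    using assms
    by (auto simp: G_def eo_contains_def eo_subgraph_def eo_isomorphic_def eo_isomorphism_def)
  moreover have "card (verts G) = n"
    by (simp add: G_def)
  ultimately show ?thesis
    unfolding avoiding_sizes_def by blast
qed

end

theory Submission
  imports Defs
begin

text \<open>
  Pass to a bipartite subgraph with half of the edges and write \<open>xy\<close> also for the rank of an
  edge. Let \<open>low v\<close> be the second smallest label at \<open>v\<close>, and \<open>top d\<close> the largest label
  \<open>ef\<close> occurring in a configuration \<open>ef < ef' < de\<close>. Avoidance forces
  \<open>top d \<le> bc\<close> whenever \<open>low b < cd < bc\<close>. Up to three edges per vertex, each edge \<open>xy\<close>
  lies strictly above \<open>low\<close> and differs from \<open>top\<close> at both ends. Take the largest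
  \<open>k\<close> such that all four of these distances are at least \<open>2 ^ k\<close>, and charge the
  edge to an end \<open>y\<close> having a distance below \<open>2 ^ (k + 1)\<close>. The edges charged to \<open>y\<close> at
  scale \<open>k\<close> have labels in three windows of length \<open>2 ^ k\<close>, and a window contains at most three
  of them. Hence there are \<open>O(n log n)\<close> edges.
\<close>

section \<open>Embedding edge-ordered paths\<close>

lemma eo_contains_eo_path:
  assumes G: "edge_ordered_graph G"
    and inj: "inj_on f {0..length ls}"
    and V: "f ` {0..length ls} \<subseteq> verts G"
    and E: "\<And>i. i < length ls \<Longrightarrow> {f i, f (Suc i)} \<in> edges G"
    and ord: "\<And>i j. i < length ls \<Longrightarrow> j < length ls \<Longrightarrow>
      ({f i, f (Suc i)}, {f j, f (Suc j)}) \<in> eord G \<longleftrightarrow> ls ! i \<le> ls ! j"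
  shows "eo_contains G (eo_path ls)"
proof -
  define F where "F = {{f i, f (Suc i)} | i. i < length ls}"
  define S where "S = \<lparr>verts = f ` {0..length ls}, edges = F, eord = Restr (eord G) F\<rparr>"
  have FE: "F \<subseteq> edges G"
    using E by (auto simp: F_def)
  have lin: "linear_order_on (edges G) (eord G)"
    using G by (simp add: edge_ordered_graph_def)
  have "linear_order_on F (Restr (eord G) F)"
  proof -
    have "refl_on F (Restr (eord G) F)" "total_on F (Restr (eord G) F)"
      using lin FE
      unfolding linear_order_on_def partial_order_on_def preorder_on_def refl_on_def total_on_def
      by blast+
    moreover have "trans (Restr (eord G) F)" "antisym (Restr (eord G) F)"
      using lin by (auto simp: linear_order_on_def partial_order_on_def preorder_on_def
          intro: trans_Restr antisym_subset)
    ultimately show ?thesis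
      by (simp add: linear_order_on_def partial_order_on_def preorder_on_def)
  qed
  moreover have "e \<subseteq> f ` {0..length ls} \<and> card e = 2" if "e \<in> F" for e
  proof -
    from that obtain i where i: "i < length ls" "e = {f i, f (Suc i)}"
      by (auto simp: F_def)
    then show ?thesis
      using G E[OF i(1)] by (auto simp: edge_ordered_graph_def)
  qed
  ultimately have S: "edge_ordered_graph S"
    by (simp add: S_def edge_ordered_graph_def)
  have "eo_subgraph S G"
    using S V FE by (simp add: S_def eo_subgraph_def)
  moreover have "eo_isomorphism f (eo_path ls) S"
    unfolding eo_isomorphism_def
  proof (intro conjI ballI)
    show "bij_betw f (verts (eo_path ls)) (verts S)"
      using inj by (simp add: bij_betw_def S_def eo_path_def)
    show "(`) f ` edges (eo_path ls) = edges S"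
    proof -
      have "edges (eo_path ls) = (\<lambda>i. {i, Suc i}) ` {..<length ls}"
        by (auto simp: eo_path_def)
      moreover have "edges S = (\<lambda>i. {f i, f (Suc i)}) ` {..<length ls}"
        by (auto simp: S_def F_def)
      ultimately show ?thesis
        by (simp add: image_image)
    qed
    fix e e' assume "e \<in> edges (eo_path ls)" "e' \<in> edges (eo_path ls)"
    then obtain i j where ij: "i < length ls" "j < length ls" "e = {i, Suc i}" "e' = {j, Suc j}"
      by (auto simp: eo_path_def)
    have "(e, e') \<in> eord (eo_path ls) \<longleftrightarrow> ls ! i \<le> ls ! j"
      using ij by (auto simp: eo_path_def path_edge_eq_iff)
    also have "\<dots> \<longleftrightarrow> (f ` e, f ` e') \<in> eord S"
      using ord[OF ij(1,2)] ij by (auto simp: S_def F_def)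
    finally show "(e, e') \<in> eord (eo_path ls) \<longleftrightarrow> (f ` e, f ` e') \<in> eord S" .
  qed
  ultimately show ?thesis
    unfolding eo_contains_def eo_isomorphic_def by blast
qed

text \<open>The labels 1, 3, 2, 5, 4 sit on ab, bc, cd, de, ef, so the increasing chain ab, cd, bc,
  ef, de fixes all comparisons by transitivity.\<close>

lemma eo_contains_P6_13254:
  fixes lab :: "'a set \<Rightarrow> nat"
  assumes G: "edge_ordered_graph G"
    and lab: "\<And>e e'. e \<in> edges G \<Longrightarrow> e' \<in> edges G \<Longrightarrow> (e, e') \<in> eord G \<longleftrightarrow> lab e \<le> lab e'"
    and E: "{a,b} \<in> edges G" "{b,c} \<in> edges G" "{c,d} \<in> edges G" "{d,e} \<in> edges G" "{e,f} \<in> edges G"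
    and dist: "distinct [a,b,c,d,e,f]"
    and ord: "lab {a,b} < lab {c,d}" "lab {c,d} < lab {b,c}"
      "lab {b,c} < lab {e,f}" "lab {e,f} < lab {d,e}"
  shows "eo_contains G P6_13254"
  unfolding P6_13254_def
proof (rule eo_contains_eo_path[where f = "\<lambda>i. [a,b,c,d,e,f] ! i"])
  have V: "{a,b,c,d,e,f} \<subseteq> verts G"
    using G E by (auto simp: edge_ordered_graph_def)
  show "inj_on ((!) [a,b,c,d,e,f]) {0..length [1,3,2,5,4]}"
    using dist by (intro inj_on_nth) auto
  show "(!) [a,b,c,d,e,f] ` {0..length [1,3,2,5,4]} \<subseteq> verts G"
  proof
    fix x assume "x \<in> (!) [a,b,c,d,e,f] ` {0..length [1,3,2,5,4]}"
    then have "x \<in> set [a,b,c,d,e,f]"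
      by (force simp del: set_simps intro: nth_mem)
    then show "x \<in> verts G"
      using V by auto
  qed
  show "{[a,b,c,d,e,f] ! i, [a,b,c,d,e,f] ! Suc i} \<in> edges G" if "i < length [1,3,2,5,4]" for i
    using that E by (auto simp: less_Suc_eq numeral_eq_Suc)
  show "({[a,b,c,d,e,f] ! i, [a,b,c,d,e,f] ! Suc i}, {[a,b,c,d,e,f] ! j, [a,b,c,d,e,f] ! Suc j}) \<in> eord G
      \<longleftrightarrow> [1,3,2,5,4] ! i \<le> ([1,3,2,5,4] ! j :: nat)"
    if "i < length [1,3,2,5,4]" "j < length [1,3,2,5,4]" for i j
    using that E ord by (auto simp: less_Suc_eq numeral_eq_Suc lab)
qed (use G in auto)

section \<open>Ranks, large cuts and small sets of naturals\<close>

text \<open>The rank of an element is the number of its predecessors, itself included. Numerical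
  labels give edges a distance, and the bound by \<open>card A\<close> keeps the number of dyadic
  scales logarithmic.\<close>

lemma linear_order_rank:
  assumes "finite A" and r: "linear_order_on A r"
  obtains lab :: "'a \<Rightarrow> nat" where
    "\<And>x y. x \<in> A \<Longrightarrow> y \<in> A \<Longrightarrow> (x, y) \<in> r \<longleftrightarrow> lab x \<le> lab y"
    "inj_on lab A"
    "\<And>x. lab x \<le> card A"
proof
  define lab where "lab x = card {z \<in> A. (z, x) \<in> r}" for x
  have r': "refl_on A r" "trans r" "antisym r" "total_on A r"
    using r by (simp_all add: linear_order_on_def partial_order_on_def preorder_on_def)
  show iff: "(x, y) \<in> r \<longleftrightarrow> lab x \<le> lab y" if "x \<in> A" "y \<in> A" for x y
  proof
    assume "(x, y) \<in> r"
    then show "lab x \<le> lab y"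
      unfolding lab_def using \<open>finite A\<close> r'(2) by (intro card_mono) (auto dest: transD)
  next
    assume le: "lab x \<le> lab y"
    show "(x, y) \<in> r"
    proof (rule ccontr)
      assume not: "(x, y) \<notin> r"
      then have yx: "(y, x) \<in> r"
        using r'(1,4) that unfolding total_on_def by (metis refl_onD)
      have "{z \<in> A. (z, y) \<in> r} \<subset> {z \<in> A. (z, x) \<in> r}"
        using yx not that r'(1,2) by (auto dest: transD refl_onD)
      then have "lab y < lab x"
        unfolding lab_def using \<open>finite A\<close> by (intro psubset_card_mono) auto
      with le show False by simp
    qed
  qed
  show "inj_on lab A"
    using iff r'(3) by (intro inj_onI) (metis antisymD order_refl)
  show "lab x \<le> card A" for x
    unfolding lab_def using \<open>finite A\<close> by (intro card_mono) auto
qed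

text \<open>Greedy induction on the vertices: the new vertex goes to the side on which at least half
  of its edges are cut, and this does not affect the other edges.\<close>

lemma ex_large_cut:
  assumes "finite V" and "\<And>e. e \<in> E \<Longrightarrow> e \<subseteq> V \<and> card e = 2"
  obtains A where "card E \<le> 2 * card {e \<in> E. card (e \<inter> A) = 1}"
proof -
  have "\<exists>A. card E \<le> 2 * card {e \<in> E. card (e \<inter> A) = 1}"
    using assms
  proof (induction V arbitrary: E rule: finite_induct)
    case empty
    then have "E = {}" by fastforce
    then show ?case by simp
  next
    case (insert v V)
    let ?E0 = "{e \<in> E. v \<notin> e}" and ?E1 = "{e \<in> E. v \<in> e}"
    have "E \<subseteq> Pow (insert v V)"
      using insert.prems by auto
    then have fin: "finite E"
      using insert.hyps(1) finite_subset by blast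
    obtain A where A: "card ?E0 \<le> 2 * card {e \<in> ?E0. card (e \<inter> A) = 1}"
      using insert.IH[of ?E0] insert.prems by auto
    \<comment> \<open>\<open>S\<close> and \<open>T\<close> are the edges at \<open>v\<close> that
      are cut when \<open>v\<close> is put outside or inside. \<open>v\<close> is removed explicitly
      because the induction hypothesis does not exclude \<open>v\<close> from
      \<open>A\<close>.\<close>
    define S where "S = {e \<in> ?E1. card (e \<inter> (A - {v})) = 1}"
    define T where "T = {e \<in> ?E1. card (e \<inter> insert v A) = 1}"
    have "?E1 \<subseteq> S \<union> T"
    proof
      fix e assume e: "e \<in> ?E1"
      then obtain x where x: "e = {v, x}" "x \<noteq> v"
        using insert.prems[of e] by (auto simp: card_2_iff doubleton_eq_iff)
      have "card (e \<inter> (A - {v})) = 1" if "x \<in> A"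
      proof -
        have "e \<inter> (A - {v}) = {x}" using x that by auto
        then show ?thesis by simp
      qed
      moreover have "card (e \<inter> insert v A) = 1" if "x \<notin> A"
      proof -
        have "e \<inter> insert v A = {v}" using x that by auto
        then show ?thesis by simp
      qed
      ultimately show "e \<in> S \<union> T"
        using e by (auto simp: S_def T_def)
    qed
    then have "card ?E1 \<le> card (S \<union> T)"
      using fin by (intro card_mono) (auto simp: S_def T_def)
    then have ST: "card ?E1 \<le> card S + card T"
      using card_Un_le[of S T] by linarith
    have split: "card {e \<in> E. P e} = card {e \<in> ?E0. P e} + card {e \<in> ?E1. P e}" for P
    proof -
      have "{e \<in> E. P e} = {e \<in> ?E0. P e} \<union> {e \<in> ?E1. P e}" by auto
      then show ?thesis
        using fin by (simp only:) (subst card_Un_disjoint; auto)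
    qed
    have E0: "{e \<in> ?E0. card (e \<inter> (A - {v})) = 1} = {e \<in> ?E0. card (e \<inter> A) = 1}"
      "{e \<in> ?E0. card (e \<inter> insert v A) = 1} = {e \<in> ?E0. card (e \<inter> A) = 1}"
    proof -
      have "e \<inter> (A - {v}) = e \<inter> A" "e \<inter> insert v A = e \<inter> A" if "v \<notin> e" for e
        using that by auto
      then show "{e \<in> ?E0. card (e \<inter> (A - {v})) = 1} = {e \<in> ?E0. card (e \<inter> A) = 1}"
        "{e \<in> ?E0. card (e \<inter> insert v A) = 1} = {e \<in> ?E0. card (e \<inter> A) = 1}"
        by (metis (no_types, lifting) mem_Collect_eq)+
    qed
    have "card E = card ?E0 + card ?E1"
      using split[of "\<lambda>_. True"] by simp
    moreover have "card {e \<in> E. card (e \<inter> (A - {v})) = 1} = card {e \<in> ?E0. card (e \<inter> A) = 1} + card S"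
      using split[of "\<lambda>e. card (e \<inter> (A - {v})) = 1"] by (simp only: S_def E0)
    moreover have "card {e \<in> E. card (e \<inter> insert v A) = 1} = card {e \<in> ?E0. card (e \<inter> A) = 1} + card T"
      using split[of "\<lambda>e. card (e \<inter> insert v A) = 1"] by (simp only: T_def E0)
    ultimately show ?case
      using A ST by (cases "card T \<le> card S") (rule exI[of _ "A - {v}"], simp, rule exI[of _ "insert v A"], simp)
  qed
  then show ?thesis using that by blast
qed

text \<open>With at least three elements the second smallest serves; otherwise the maximum does,
  since nothing lies above it and the second clause is vacuous.\<close>

lemma ex_second_smallest:
  fixes S :: "nat set"
  assumes "finite S"
  shows "\<exists>l. card {s \<in> S. s \<le> l} \<le> 2 \<and> (\<forall>s\<in>S. l < s \<longrightarrow> (\<exists>a\<in>S. \<exists>b\<in>S. a < b \<and> b \<le> l))"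
proof (cases "card S \<le> 2")
  case True
  have "card {s \<in> S. s \<le> Max S} \<le> 2"
  proof -
    have "card {s \<in> S. s \<le> Max S} \<le> card S"
      using assms by (intro card_mono) auto
    with True show ?thesis by simp
  qed
  moreover have "\<not> Max S < s" if "s \<in> S" for s
    using assms that by (simp add: leD)
  ultimately show ?thesis by blast
next
  case False
  define a where "a = Min S"
  define b where "b = Min (S - {a})"
  have "S \<noteq> {}" using False by auto
  then have a: "a \<in> S" using assms by (simp add: a_def)
  have "S - {a} \<noteq> {}"
  proof
    assume "S - {a} = {}"
    then have "card S \<le> card {a}" by (intro card_mono) auto
    with False show False by simp
  qed
  then have b: "b \<in> S - {a}" using assms by (metis Min_in b_def finite_Diff)
  have ab: "a < b" using b assms by (metis DiffD1 DiffD2 Min_le a_def insertI1 order_le_neq_trans)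
  have "{s \<in> S. s \<le> b} \<subseteq> {a, b}"
  proof
    fix s assume s: "s \<in> {s \<in> S. s \<le> b}"
    show "s \<in> {a, b}"
    proof (rule ccontr)
      assume "s \<notin> {a, b}"
      with s have "s \<in> S - {a}" "s < b" by auto
      moreover have "b \<le> s" unfolding b_def using \<open>s \<in> S - {a}\<close> assms by (intro Min_le) auto
      ultimately show False by simp
    qed
  qed
  then have "card {s \<in> S. s \<le> b} \<le> card {a, b}" by (intro card_mono) auto
  also have "\<dots> \<le> 2" by (simp add: card_insert_if)
  finally show ?thesis using a b ab by (intro exI[of _ b]) auto
qed

lemma ex_four_increasing:
  fixes S :: "nat set"
  assumes "finite S" and "3 < card S"
  obtains a b c d where "a \<in> S" "b \<in> S" "c \<in> S" "d \<in> S" "a < b" "b < c" "c < d"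
proof -
  let ?xs = "sorted_list_of_set S"
  have len: "3 < length ?xs" and set: "set ?xs = S"
    using assms by simp_all
  have "sorted_wrt (<) ?xs" by simp
  then have less: "?xs ! i < ?xs ! j" if "i < j" "j < length ?xs" for i j
    using that sorted_wrt_nth_less by blast
  have mem: "?xs ! i \<in> S" if "i < length ?xs" for i
    using that set nth_mem by blast
  show ?thesis
    using that[of "?xs ! 0" "?xs ! 1" "?xs ! 2" "?xs ! 3"] len less mem by simp
qed

section \<open>Labelled bipartite graphs and the consequence of avoidance\<close>

locale labelled_bigraph =
  fixes V :: "'a set" and E :: "'a set set" and side :: "'a set" and lab :: "'a set \<Rightarrow> nat" and N :: nat
  assumes finV: "finite V"
    and edge: "\<And>e. e \<in> E \<Longrightarrow> e \<subseteq> V \<and> card e = 2 \<and> card (e \<inter> side) = 1"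
    and inj: "inj_on lab E"
    and le_N: "\<And>e. e \<in> E \<Longrightarrow> lab e \<le> N"
    and avoid: "\<And>a b c d e f. \<lbrakk>distinct [a,b,c,d,e,f]; {a,b} \<in> E; {b,c} \<in> E; {c,d} \<in> E; {d,e} \<in> E; {e,f} \<in> E;
      lab {a,b} < lab {c,d}; lab {c,d} < lab {b,c}; lab {b,c} < lab {e,f}; lab {e,f} < lab {d,e}\<rbrakk>
      \<Longrightarrow> False"
begin

lemma finE: "finite E"
proof -
  have "E \<subseteq> Pow V" using edge by auto
  then show ?thesis using finV finite_subset by blast
qed

lemma edge_side: "{x, y} \<in> E \<Longrightarrow> x \<in> side \<longleftrightarrow> y \<notin> side"
  using edge[of "{x, y}"] by (cases "x \<in> side"; cases "y \<in> side") (auto simp: Int_insert_left)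

definition star :: "'a \<Rightarrow> 'a set set" where
  "star v = {e \<in> E. v \<in> e}"

lemma finite_star: "finite (star v)"
  using finE by (simp add: star_def)

lemma starE:
  assumes "e \<in> star v"
  obtains x where "e = {v, x}" "x \<noteq> v" "{v, x} \<in> E"
  using assms edge[of e] by (auto simp: star_def card_2_iff doubleton_eq_iff insert_commute)

text \<open>Only the two chosen properties matter. At a vertex with fewer than three edges they
  force \<open>low v\<close> to be at least every label there.\<close>

definition low :: "'a \<Rightarrow> nat" where
  "low v = (SOME l. card {s \<in> lab ` star v. s \<le> l} \<le> 2 \<and>
     (\<forall>s\<in>lab ` star v. l < s \<longrightarrow> (\<exists>a\<in>lab ` star v. \<exists>b\<in>lab ` star v. a < b \<and> b \<le> l)))"

lemma low: "card {s \<in> lab ` star v. s \<le> low v} \<le> 2 \<and>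
     (\<forall>s\<in>lab ` star v. low v < s \<longrightarrow> (\<exists>a\<in>lab ` star v. \<exists>b\<in>lab ` star v. a < b \<and> b \<le> low v))"
  unfolding low_def by (rule someI_ex, rule ex_second_smallest) (simp add: finite_star)

lemma card_star_le_low: "card {e \<in> star v. lab e \<le> low v} \<le> 2"
proof -
  have "inj_on lab {e \<in> star v. lab e \<le> low v}"
    using inj by (rule inj_on_subset) (auto simp: star_def)
  then have "card {e \<in> star v. lab e \<le> low v} = card (lab ` {e \<in> star v. lab e \<le> low v})"
    by (simp add: card_image)
  also have "lab ` {e \<in> star v. lab e \<le> low v} = {s \<in> lab ` star v. s \<le> low v}"
    by auto
  finally show ?thesis using low by simp
qed

text \<open>Two different edges at \<open>q\<close> have labels at most \<open>low q\<close>, and at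
  most one of them leads to \<open>z\<close>.\<close>

lemma low_avoiding:
  assumes "{q, y} \<in> E" "low q < lab {q, y}"
  obtains a where "a \<noteq> z" "{a, q} \<in> E" "lab {a, q} \<le> low q"
proof -
  have "lab {q, y} \<in> lab ` star q"
    using assms by (auto simp: star_def)
  then obtain e1 e2 where e: "e1 \<in> star q" "e2 \<in> star q" "lab e1 < lab e2" "lab e2 \<le> low q"
    using low[of q] assms(2) by blast
  obtain a1 a2 where a: "e1 = {a1, q}" "e2 = {a2, q}"
    using e starE by (metis insert_commute)
  with e have "a1 \<noteq> a2" by auto
  then show ?thesis
    using e a that[of a1] that[of a2] by (cases "a1 = z") (simp_all add: star_def)
qed

text \<open>These are possible ends d, e, f of the forbidden path. The edge to \<open>f'\<close> is
  a spare last edge: its label also lies below that of de and above everything below ef.\<close>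

definition peaks :: "'a \<Rightarrow> nat set" where
  "peaks d = {lab {e, f} | e f f'. {d, e} \<in> E \<and> {e, f} \<in> E \<and> {e, f'} \<in> E \<and>
     lab {e, f} < lab {e, f'} \<and> lab {e, f'} < lab {d, e}}"

text \<open>The inserted 0 is the value when there are no peaks. No natural number lies below it, so
  \<open>top_cases\<close> still holds.\<close>

definition top :: "'a \<Rightarrow> nat" where
  "top d = Max (insert 0 (peaks d))"

lemma finite_peaks: "finite (peaks d)"
  by (rule finite_subset[of _ "lab ` E"]) (auto simp: peaks_def finE)

lemma le_top:
  "\<lbrakk>{d, e} \<in> E; {e, f} \<in> E; {e, f'} \<in> E; lab {e, f} < lab {e, f'}; lab {e, f'} < lab {d, e}\<rbrakk>
    \<Longrightarrow> lab {e, f} \<le> top d"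
  unfolding top_def using finite_peaks by (intro Max_ge) (auto simp: peaks_def)

lemma top_cases:
  assumes "t < top d"
  obtains e f f' where "{d, e} \<in> E" "{e, f} \<in> E" "{e, f'} \<in> E"
    "lab {e, f} < lab {e, f'}" "lab {e, f'} < lab {d, e}" "t < lab {e, f}"
proof -
  have "top d \<in> insert 0 (peaks d)"
    unfolding top_def using finite_peaks by (intro Max_in) auto
  with assms have "top d \<in> peaks d" by auto
  with that assms show ?thesis by (auto simp: peaks_def)
qed

text \<open>
  The walk \<open>a, b, c, d, e, f\<close> provided by the definitions of \<open>low\<close> and \<open>top\<close> is a path:
  bipartiteness separates the parity classes, and the two candidates for \<open>a\<close> and for \<open>f\<close>
  leave room for \<open>a \<noteq> e\<close> and \<open>f \<noteq> b\<close>.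
\<close>

lemma top_le:
  assumes cd: "{c, d} \<in> E" and bc: "{b, c} \<in> E"
    and ord: "low b < lab {c, d}" "lab {c, d} < lab {b, c}"
  shows "top d \<le> lab {b, c}"
proof (rule ccontr)
  assume "\<not> top d \<le> lab {b, c}"
  then have "lab {b, c} < top d" by simp
  then obtain e f1 f2 where e: "{d, e} \<in> E" "{e, f1} \<in> E" "{e, f2} \<in> E"
    "lab {e, f1} < lab {e, f2}" "lab {e, f2} < lab {d, e}" "lab {b, c} < lab {e, f1}"
    by (rule top_cases)
  then obtain f where f: "f \<noteq> b" "{e, f} \<in> E" "lab {e, f} < lab {d, e}" "lab {b, c} < lab {e, f}"
    by (metis order.strict_trans order_less_irrefl)
  obtain a where a: "a \<noteq> e" "{a, b} \<in> E" "lab {a, b} \<le> low b"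
    using low_avoiding[of b c e] bc ord by auto
  have ab: "lab {a, b} < lab {c, d}"
    using a ord by simp
  \<comment> \<open>Each of these equalities would identify two consecutive edges of the walk, whose
    labels differ.\<close>
  have "a \<noteq> c" "b \<noteq> d" "c \<noteq> e" "d \<noteq> f"
    using ab ord e f by (auto simp: insert_commute)
  moreover have "a \<noteq> b" "b \<noteq> c" "c \<noteq> d" "d \<noteq> e" "e \<noteq> f" "a \<noteq> d" "b \<noteq> e" "c \<noteq> f" "a \<noteq> f"
    using edge_side[OF a(2)] edge_side[OF bc] edge_side[OF cd] edge_side[OF e(1)] edge_side[OF f(2)]
    by auto
  ultimately have "distinct [a, b, c, d, e, f]"
    using a(1) f(1) by simp
  then show False
    using avoid[of a b c d e f] a(2) bc cd e(1) f ab ord by simp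
qed

section \<open>Dyadic distances and charging\<close>

definition far :: "nat \<Rightarrow> 'a \<Rightarrow> nat \<Rightarrow> bool" where
  "far k v t \<longleftrightarrow> low v + 2 ^ k \<le> t \<and> (t + 2 ^ k \<le> top v \<or> top v + 2 ^ k \<le> t)"

text \<open>
  Among four edges of a star whose labels are this close, the third smallest label lies neither
  below \<open>top\<close> of the far endpoint (because of the fourth edge) nor above it (because of the
  first two).
\<close>

lemma card_window_le:
  assumes S: "S \<subseteq> star y"
    and far: "\<And>x. {y, x} \<in> S \<Longrightarrow> far k x (lab {y, x})"
    and win: "\<And>e e'. e \<in> S \<Longrightarrow> e' \<in> S \<Longrightarrow> lab e < lab e' + 2 ^ k"
  shows "card S \<le> 3"
proof (rule ccontr)
  assume "\<not> card S \<le> 3"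
  moreover have "inj_on lab S"
    using inj S by (auto simp: star_def intro: inj_on_subset)
  ultimately have "3 < card (lab ` S)"
    by (simp add: card_image)
  moreover have "finite (lab ` S)"
    using S finite_star finite_subset by blast
  ultimately obtain e1 e2 e3 e4 where e: "e1 \<in> S" "e2 \<in> S" "e3 \<in> S" "e4 \<in> S"
    "lab e1 < lab e2" "lab e2 < lab e3" "lab e3 < lab e4"
    by (elim ex_four_increasing[rotated]) auto
  then obtain x1 x2 p q where x: "e1 = {y, x1}" "e2 = {y, x2}" "e3 = {y, p}" "e4 = {y, q}"
    using S starE by (metis subsetD)
  have E: "{y, x1} \<in> E" "{y, x2} \<in> E" "{y, p} \<in> E" "{y, q} \<in> E"
    using S e x by (auto simp: star_def)
  have fp: "far k p (lab e3)" and fq: "far k q (lab e4)"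
    using far e x by auto
  \<comment> \<open>The label of \<open>e4\<close> exceeds \<open>low q\<close> by at least
    \<open>2 ^ k\<close>, while \<open>e3\<close> is less than \<open>2 ^ k\<close> below
    \<open>e4\<close>.\<close>
  have "low q < lab e3"
    using fq win[OF e(4,3)] by (auto simp: far_def)
  then have "top p \<le> lab e4"
    using top_le[of y p q] E e x by (auto simp: insert_commute)
  \<comment> \<open>The other alternative of \<open>far\<close> at \<open>p\<close> would put
    \<open>e3\<close> at least \<open>2 ^ k\<close> below \<open>top p\<close>, hence below
    \<open>e4\<close>, outside the window.\<close>
  then have "top p + 2 ^ k \<le> lab e3"
    using fp win[OF e(4,3)] by (auto simp: far_def)
  moreover have "lab e1 \<le> top p"
    using le_top[of p y x1 x2] E e x by (auto simp: insert_commute)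
  ultimately show False
    using win[OF e(3,1)] by linarith
qed

text \<open>These are exactly the edges at \<open>v\<close> that fail \<open>far 0 v\<close>: at
  most two because of \<open>low\<close> and one because of \<open>top\<close>.\<close>

definition rare :: "'a \<Rightarrow> 'a set set" where
  "rare v = {e \<in> star v. lab e \<le> low v \<or> lab e = top v}"

lemma card_rare_le: "card (rare v) \<le> 3"
proof -
  have "card {e \<in> star v. lab e = top v} \<le> 1"
    using inj finite_star[of v] unfolding One_nat_def
    by (subst card_le_Suc0_iff_eq) (auto simp del: One_nat_def simp: star_def inj_on_def intro: rev_finite_subset)
  moreover have "rare v = {e \<in> star v. lab e \<le> low v} \<union> {e \<in> star v. lab e = top v}"
    by (auto simp: rare_def)
  ultimately show ?thesis
    using card_star_le_low[of v]
      card_Un_le[of "{e \<in> star v. lab e \<le> low v}" "{e \<in> star v. lab e = top v}"]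
    by simp
qed

definition at_scale :: "'a \<Rightarrow> nat \<Rightarrow> 'a set set" where
  "at_scale v k = {e \<in> star v. (\<forall>x\<in>e. far k x (lab e)) \<and> \<not> far (Suc k) v (lab e)}"

lemma card_at_scale_le: "card (at_scale v k) \<le> 9"
proof -
  define W where "W w = {e \<in> at_scale v k. w \<le> lab e \<and> lab e < w + 2 ^ k}" for w
  have W: "card (W w) \<le> 3" for w
    by (rule card_window_le[of _ v k]) (auto simp: W_def at_scale_def)
  \<comment> \<open>Satisfying \<open>far k\<close> but not \<open>far (Suc k)\<close> leaves a
    distance in the range from \<open>2 ^ k\<close> to below \<open>2 ^ Suc k\<close>: above
    \<open>low\<close>, below \<open>top\<close> or above \<open>top\<close>. The \<open>Suc\<close>
    in the middle window arises because below \<open>top\<close> the range is open at its lower end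
    and closed at its upper end.\<close>
  have "at_scale v k \<subseteq> W (low v + 2 ^ k) \<union> W (Suc (top v) - 2 ^ Suc k) \<union> W (top v + 2 ^ k)"
    by (auto simp: W_def at_scale_def far_def star_def)
  then have "card (at_scale v k) \<le>
      card (W (low v + 2 ^ k) \<union> W (Suc (top v) - 2 ^ Suc k) \<union> W (top v + 2 ^ k))"
    using finite_star by (intro card_mono) (auto simp: W_def at_scale_def)
  also have "\<dots> \<le> card (W (low v + 2 ^ k)) + card (W (Suc (top v) - 2 ^ Suc k)) + card (W (top v + 2 ^ k))"
    by (meson card_Un_le add_le_mono1 le_trans)
  also have "\<dots> \<le> 9"
    using W[of "low v + 2 ^ k"] W[of "Suc (top v) - 2 ^ Suc k"] W[of "top v + 2 ^ k"] by linarith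
  finally show ?thesis .
qed

theorem card_edges_le:
  assumes K: "N < 2 ^ K"
  shows "card E \<le> card V * (3 + 9 * K)"
proof -
  define B where "B v = rare v \<union> (\<Union>k<K. at_scale v k)" for v
  have "E \<subseteq> (\<Union>v\<in>V. B v)"
  proof
    fix e assume e: "e \<in> E"
    show "e \<in> (\<Union>v\<in>V. B v)"
    proof (cases "\<exists>v\<in>e. e \<in> rare v")
      case True
      then show ?thesis using edge[OF e] by (auto simp: B_def)
    next
      case False
      then have far0: "\<forall>v\<in>e. far 0 v (lab e)"
        using e by (fastforce simp: rare_def star_def far_def)
      have "e \<noteq> {}" using edge[OF e] by auto
      \<comment> \<open>At scale \<open>K\<close> the label would be at least \<open>2 ^ K\<close>,
        hence above \<open>N\<close>.\<close>
      then have "\<not> (\<forall>v\<in>e. far K v (lab e))"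
        using le_N[OF e] K by (auto simp: far_def)
      \<comment> \<open>All ends are far at scale 0 and not all are at scale \<open>K\<close>, so
        the property is lost between some consecutive scales.\<close>
      then obtain k where k: "k < K" "\<forall>v\<in>e. far k v (lab e)" "\<not> (\<forall>v\<in>e. far (Suc k) v (lab e))"
        using far0 by (induction K) (auto simp: less_Suc_eq)
      then obtain v where v: "v \<in> e" "\<not> far (Suc k) v (lab e)"
        by blast
      with k e have "e \<in> at_scale v k"
        by (simp add: at_scale_def star_def)
      then have "e \<in> B v"
        using k(1) by (auto simp: B_def)
      then show ?thesis
        using v(1) edge[OF e] by blast
    qed
  qed
  moreover have "finite (B v)" for v
    by (rule finite_subset[OF _ finE]) (auto simp: B_def rare_def at_scale_def star_def)
  ultimately have "card E \<le> card (\<Union>v\<in>V. B v)"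
    using finV by (intro card_mono) auto
  also have "\<dots> \<le> (\<Sum>v\<in>V. card (B v))"
    using finV by (rule card_UN_le)
  also have "\<dots> \<le> (\<Sum>v\<in>V. 3 + 9 * K)"
  proof (rule sum_mono)
    fix v
    have "card (B v) \<le> card (rare v) + card (\<Union>k<K. at_scale v k)"
      unfolding B_def by (rule card_Un_le)
    also have "card (\<Union>k<K. at_scale v k) \<le> (\<Sum>k<K. card (at_scale v k))"
      by (rule card_UN_le) simp
    also have "\<dots> \<le> (\<Sum>k<K. 9)"
      by (intro sum_mono card_at_scale_le)
    finally show "card (B v) \<le> 3 + 9 * K"
      using card_rare_le[of v] by simp
  qed
  finally show ?thesis by simp
qed

end

section \<open>Bounds for the extremal number\<close>

lemma card_edges_P6_13254_avoiding:
  assumes G: "edge_ordered_graph G" and avoids: "eo_avoids G P6_13254"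
    and K: "card (edges G) < 2 ^ K"
  shows "card (edges G) \<le> 2 * card (verts G) * (3 + 9 * K)"
proof -
  have edge: "\<And>e. e \<in> edges G \<Longrightarrow> e \<subseteq> verts G \<and> card e = 2" and V: "finite (verts G)"
    and lin: "linear_order_on (edges G) (eord G)"
    using G by (auto simp: edge_ordered_graph_def)
  have "edges G \<subseteq> Pow (verts G)"
    using edge by auto
  then have "finite (edges G)"
    using V finite_subset by blast
  then obtain lab :: "'a set \<Rightarrow> nat" where lab:
    "\<And>x y. x \<in> edges G \<Longrightarrow> y \<in> edges G \<Longrightarrow> (x, y) \<in> eord G \<longleftrightarrow> lab x \<le> lab y"
    "inj_on lab (edges G)" "\<And>x. lab x \<le> card (edges G)"
    using lin linear_order_rank[of "edges G" "eord G"] by blast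
  obtain A where A: "card (edges G) \<le> 2 * card {e \<in> edges G. card (e \<inter> A) = 1}"
    using ex_large_cut[OF V edge] by blast
  \<comment> \<open>The labels are ranks in the whole graph, so \<open>N\<close> counts all edges
    and not only those that are cut.\<close>
  interpret labelled_bigraph "verts G" "{e \<in> edges G. card (e \<inter> A) = 1}" A lab "card (edges G)"
  proof
    show "inj_on lab {e \<in> edges G. card (e \<inter> A) = 1}"
      using lab(2) by (rule inj_on_subset) auto
    show False if "distinct [a,b,c,d,e,f]"
      "{a,b} \<in> {e \<in> edges G. card (e \<inter> A) = 1}" "{b,c} \<in> {e \<in> edges G. card (e \<inter> A) = 1}"
      "{c,d} \<in> {e \<in> edges G. card (e \<inter> A) = 1}" "{d,e} \<in> {e \<in> edges G. card (e \<inter> A) = 1}"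
      "{e,f} \<in> {e \<in> edges G. card (e \<inter> A) = 1}"
      "lab {a,b} < lab {c,d}" "lab {c,d} < lab {b,c}" "lab {b,c} < lab {e,f}" "lab {e,f} < lab {d,e}"
      for a b c d e f
      using that avoids eo_contains_P6_13254[OF G lab(1), of a b c d e f] by blast
  qed (use V edge lab(3) in auto)
  show ?thesis
    using A card_edges_le[OF K] by simp
qed

text \<open>The crude bound \<open>n ^ 2\<close> on the number of edges makes the number
  \<open>K\<close> of scales depend on \<open>n\<close> alone.\<close>

lemma ex_less_P6_13254_le:
  assumes "n ^ 2 < 2 ^ K"
  shows "ex_less n P6_13254 \<le> 2 * n * (3 + 9 * K)"
proof -
  have "edges P6_13254 \<noteq> {}"
    by (auto simp: P6_13254_def eo_path_def)
  then have "ex_less n P6_13254 \<in> avoiding_sizes n P6_13254"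
    unfolding ex_less_def by (intro Max_in finite_avoiding_sizes avoiding_sizes_nonempty)
  then obtain G :: "nat eograph" where G: "edge_ordered_graph G" "card (verts G) = n"
    "eo_avoids G P6_13254" "ex_less n P6_13254 = card (edges G)"
    by (auto simp: avoiding_sizes_def)
  have V: "finite (verts G)"
    using G(1) by (simp add: edge_ordered_graph_def)
  have "edges G \<subseteq> {e. e \<subseteq> verts G \<and> card e = 2}"
    using G(1) by (auto simp: edge_ordered_graph_def)
  then have "card (edges G) \<le> card {e. e \<subseteq> verts G \<and> card e = 2}"
    using V by (intro card_mono) auto
  also have "\<dots> = n choose 2"
    using n_subsets[OF V, of 2] G(2) by simp
  also have "\<dots> \<le> n ^ 2"
    using binomial_fact_pow[of n 2] by (simp add: fact_2)
  finally show ?thesis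
    using card_edges_P6_13254_avoiding[OF G(1,3), of K] G(2,4) assms by simp
qed

lemma ex_less_P6_13254_le_n_ln:
  assumes n: "3 \<le> n"
  shows "real (ex_less n P6_13254) \<le> 96 * (real n * ln (real n))"
proof -
  define K where "K = Suc (nat \<lfloor>log 2 (n ^ 2)\<rfloor>)"
  have ln: "1 \<le> ln (real n)"
    using n exp_le by (subst ln_ge_iff) auto
  \<comment> \<open>This is \<open>ln x \<le> x - 1\<close> at x = 1/2.\<close>
  have ln2: "1 / 2 \<le> ln (2 :: real)"
    using ln_le_minus_one[of "1 / 2 :: real"] by (simp add: ln_div)
  have "log 2 (real (n ^ 2)) < real K"
    unfolding K_def by linarith
  then have "real (n ^ 2) < 2 powr real K"
    using n by (subst (asm) log_less_iff) auto
  then have K: "n ^ 2 < 2 ^ K"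
    by (simp add: powr_realpow) (metis of_nat_less_iff of_nat_numeral of_nat_power)
  have "0 \<le> log 2 (real (n ^ 2))"
    using n by (intro zero_le_log_cancel_iff[THEN iffD2]) auto
  then have "real K \<le> 1 + log 2 (real (n ^ 2))"
    unfolding K_def by linarith
  also have "\<dots> = 1 + 2 * (ln (real n) / ln 2)"
    using n by (simp add: log_def ln_realpow)
  also have "ln (real n) / ln 2 \<le> ln (real n) / (1 / 2)"
    using ln ln2 by (intro divide_left_mono) auto
  finally have K': "real K \<le> 1 + 4 * ln (real n)"
    by simp
  have "real (ex_less n P6_13254) \<le> real (2 * n * (3 + 9 * K))"
    using ex_less_P6_13254_le[OF K] by (simp only: of_nat_le_iff)
  also have "\<dots> = 2 * n * (3 + 9 * real K)"
    by simp
  \<comment> \<open>Here 3 + 9 (1 + 4 ln n) = 12 + 36 ln n, and 12 is at most 12 ln n since ln n is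
    at least 1; this gives 96 = 2 * 48.\<close>
  also have "\<dots> \<le> 2 * n * (48 * ln (real n))"
    using K' ln by (intro mult_left_mono) auto
  finally show ?thesis by simp
qed

theorem theorem5:
  shows "(\<lambda>n. real (ex_less n P6_13254)) \<in> O(\<lambda>n. real n * (ln (real n))\<^sup>2)"
proof (rule bigoI[where c = 96])
  show "\<forall>\<^sub>F n in at_top. norm (real (ex_less n P6_13254)) \<le> 96 * norm (real n * (ln (real n))\<^sup>2)"
    using eventually_ge_at_top[of 3]
  proof eventually_elim
    fix n :: nat assume n: "3 \<le> n"
    \<comment> \<open>The bound already proved has a single logarithm; from n = 3 on, a second
      factor ln n only enlarges it.\<close>
    have "1 \<le> ln (real n)"
      using n exp_le by (subst ln_ge_iff) auto
    then have "real n * ln (real n) \<le> real n * (ln (real n))\<^sup>2"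
      by (intro mult_left_mono) (auto simp: self_le_power)
    then show "norm (real (ex_less n P6_13254)) \<le> 96 * norm (real n * (ln (real n))\<^sup>2)"
      using ex_less_P6_13254_le_n_ln[OF n] by simp
  qed
qed

end
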